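(* Let $d_A,d_B\ge 1$ be integers, $n=d_Ad_B$, and let $\rho(t)$ be a family of density matrices on $\mathbb{C}^{d_A}\otimes\mathbb{C}^{d_B}$, depending on a real parameter $t$ in a neighbourhood of $t_0$ and differentiable at $t_0$ with derivative $\dot\rho(t_0)$. Assume that the partial transpose $\rho^{T_B}(t_0)$ is invertible, and let $\rho^{T_B}(t_0)=U\Lambda U^\dagger$ be an eigendecomposition, with $U$ unitary and $\Lambda$ real diagonal. Then the negativity $\mathcal{N}(t)=\mathcal{N}(\rho(t))$ is differentiable at $t_0$ and $$\left.\frac{d\mathcal{N}}{dt}\right|_{t=t_0}=\frac12\,\mathrm{vec}^T\!\left[U^{*}\,\mathrm{sign}(\Lambda)\,U^{T}\right]K_B\,\mathrm{vec}\,\dot\rho(t_0).$$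
   Context: A density matrix on $\mathbb{C}^{d_A}\otimes\mathbb{C}^{d_B}$ is a positive semidefinite Hermitian $d_Ad_B\times d_Ad_B$ complex matrix of unit trace. The partial transpose $X\mapsto X^{T_B}$ is the complex-linear map on $d_Ad_B\times d_Ad_B$ matrices with $(Y\otimes Z)^{T_B}=Y\otimes Z^T$ for $Y$ of size $d_A\times d_A$ and $Z$ of size $d_B\times d_B$. The trace norm is $\|X\|_1=\mathrm{Tr}\sqrt{X^\dagger X}$, and the negativity of a density matrix $\rho$ is $\mathcal{N}(\rho)=\tfrac12(\|\rho^{T_B}\|_1-1)$. For a matrix $X$, $X^*$ is the entrywise complex conjugate, $X^\dagger=(X^* )^T$, $\mathrm{vec}\,X$ is the column vector obtained by stacking the columns of $X$, and $\mathrm{vec}^TX=(\mathrm{vec}\,X)^T$. For a real diagonal matrix $\Lambda$, $\mathrm{sign}(\Lambda)$ is the diagonal matrix of the signs of its entries. $J_m^{ij}$ is the $m\times m$ matrix with $(J_m^{ij})_{kl}=\delta_{ik}\delta_{jl}$, $I_m$ is the $m\times m$ identity, and $$K_B=\sum_{i,j=1}^{d_B}\left(I_{d_A}\otimes J_{d_B}^{ji}\right)\otimes\left(I_{d_A}\otimes J_{d_B}^{ij}\right),$$ with $\otimes$ the Kronecker product. *)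

theory Defs
  imports "HOL-Analysis.Analysis"
begin

text \<open>
  An \<open>m \<times> m\<close> matrix is an element of \<open>complex^'m^'m\<close> with \<open>CARD('m) = m\<close>.  A space such as
  \<open>C^dA \<otimes> C^dB\<close> has the product type \<open>'a \<times> 'b\<close> as its index type, where \<open>CARD('a) = dA\<close> and
  \<open>CARD('b) = dB\<close>; both are automatically at least 1.  A pair of indices stands for a position
  in the lexicographic order (first component most significant), which is the usual order for
  Kronecker products.  No formula below depends on the order chosen on \<open>'a\<close> and \<open>'b\<close>.
\<close>

definition cconj :: "complex^'n^'m \<Rightarrow> complex^'n^'m" where
  "cconj X = map_matrix cnj X"

definition dagger :: "complex^'n^'m \<Rightarrow> complex^'m^'n" where
  "dagger X = transpose (cconj X)"

definition hermitian :: "complex^'n^'n \<Rightarrow> bool" where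
  "hermitian X \<longleftrightarrow> dagger X = X"

definition unitary :: "complex^'n^'n \<Rightarrow> bool" where
  "unitary U \<longleftrightarrow> dagger U ** U = mat 1 \<and> U ** dagger U = mat 1"

text \<open>For Hermitian \<open>X\<close> the quadratic form below is real, so taking \<open>Re\<close> loses nothing.\<close>

definition psd :: "complex^'n^'n \<Rightarrow> bool" where
  "psd X \<longleftrightarrow> hermitian X \<and> (\<forall>v. 0 \<le> Re (\<Sum>i\<in>UNIV. cnj (v $ i) * (X *v v) $ i))"

definition density_matrix :: "complex^'n^'n \<Rightarrow> bool" where
  "density_matrix X \<longleftrightarrow> psd X \<and> trace X = 1"

text \<open>The square root of a positive semidefinite matrix: its unique positive semidefinite root.\<close>

definition psd_sqrt :: "complex^'n^'n \<Rightarrow> complex^'n^'n" where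
  "psd_sqrt X = (THE Y. psd Y \<and> Y ** Y = X)"

text \<open>The trace is that of a positive semidefinite matrix, hence real; \<open>Re\<close> only changes the type.\<close>

definition trace_norm :: "complex^'n^'n \<Rightarrow> real" where
  "trace_norm X = Re (trace (psd_sqrt (dagger X ** X)))"

definition kron ::
    "complex^'n::finite^'m::finite \<Rightarrow> complex^'q::finite^'p::finite \<Rightarrow> complex^('n \<times> 'q)^('m \<times> 'p)" where
  "kron Y Z = (\<chi> i j. Y $ fst i $ fst j * Z $ snd i $ snd j)"

definition unit_mat :: "'n \<Rightarrow> 'n \<Rightarrow> complex^'n^'n" where
  "unit_mat i j = (\<chi> k l. if i = k \<and> j = l then 1 else 0)"

text \<open>
  The partial transpose is given by its entries; \<open>partial_transpose_unique\<close> below identifies it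
  as the complex-linear map sending \<open>kron Y Z\<close> to \<open>kron Y (transpose Z)\<close>.
\<close>

definition partial_transpose ::
    "complex^('a::finite \<times> 'b::finite)^('a \<times> 'b) \<Rightarrow> complex^('a \<times> 'b)^('a \<times> 'b)" where
  "partial_transpose X = (\<chi> i j. X $ (fst i, snd j) $ (fst j, snd i))"

lemma partial_transpose_add: "partial_transpose (X + Y) = partial_transpose X + partial_transpose Y"
  by (simp add: partial_transpose_def vec_eq_iff)

lemma partial_transpose_scale:
  "partial_transpose (map_matrix ((*) c) X) = map_matrix ((*) c) (partial_transpose X)"
  by (simp add: partial_transpose_def vec_eq_iff)

lemma partial_transpose_kron: "partial_transpose (kron Y Z) = kron Y (transpose Z)"
  by (simp add: partial_transpose_def kron_def transpose_def vec_eq_iff)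

lemma kron_unit_mat_expansion:
  fixes X :: "complex^('a::finite \<times> 'b::finite)^('a \<times> 'b)"
  shows "X = (\<Sum>p\<in>UNIV. map_matrix ((*) (X $ fst p $ snd p))
           (kron (unit_mat (fst (fst p)) (fst (snd p))) (unit_mat (snd (fst p)) (snd (snd p)))))"
    (is "X = ?S")
proof -
  have "?S $ i $ j = X $ i $ j" for i j
  proof -
    have "?S $ i $ j = (\<Sum>p\<in>UNIV. if p = (i, j) then X $ fst p $ snd p else 0)"
      unfolding sum_component
      by (rule sum.cong) (auto simp: kron_def unit_mat_def prod_eq_iff)
    then show ?thesis by simp
  qed
  then show ?thesis by (simp add: vec_eq_iff)
qed

lemma partial_transpose_unique:
  fixes T :: "complex^('a::finite \<times> 'b::finite)^('a \<times> 'b) \<Rightarrow> complex^('a \<times> 'b)^('a \<times> 'b)"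
  assumes add: "\<And>X Y. T (X + Y) = T X + T Y"
    and scale: "\<And>c X. T (map_matrix ((*) c) X) = map_matrix ((*) c) (T X)"
    and kron: "\<And>Y Z. T (kron Y Z) = kron Y (transpose Z)"
  shows "T = partial_transpose"
proof
  fix X :: "complex^('a \<times> 'b)^('a \<times> 'b)"
  have sums: "F (\<Sum>p\<in>A. g p) = (\<Sum>p\<in>A. F (g p))"
    if "\<And>X Y. F (X + Y) = F X + F Y" "finite A"
    for F :: "complex^('a \<times> 'b)^('a \<times> 'b) \<Rightarrow> complex^('a \<times> 'b)^('a \<times> 'b)"
      and g :: "('a \<times> 'b) \<times> ('a \<times> 'b) \<Rightarrow> _" and A
  proof -
    have "F 0 = 0" using that(1)[of 0 0] by simp
    with that(2) show ?thesis by (induction A rule: finite_induct) (simp_all add: that(1))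
  qed
  show "T X = partial_transpose X"
    by (subst (1 2) kron_unit_mat_expansion[of X])
       (simp add: sums[of T, OF add] sums[of partial_transpose, OF partial_transpose_add]
          scale kron partial_transpose_scale partial_transpose_kron)
qed

definition negativity :: "complex^('a::finite \<times> 'b::finite)^('a \<times> 'b) \<Rightarrow> real" where
  "negativity X = (trace_norm (partial_transpose X) - 1) / 2"

definition real_diagonal :: "complex^'n^'n \<Rightarrow> bool" where
  "real_diagonal L \<longleftrightarrow> (\<forall>i j. i \<noteq> j \<longrightarrow> L $ i $ j = 0) \<and> (\<forall>i. L $ i $ i \<in> \<real>)"

definition sign_mat :: "complex^'n^'n \<Rightarrow> complex^'n^'n" where
  "sign_mat L = (\<chi> i j. if i = j then complex_of_real (sgn (Re (L $ i $ i))) else 0)"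

text \<open>
  The column vector obtained by stacking columns, as a one-column matrix.  The column index of
  \<open>X\<close> is the first, most significant, component of the index.
\<close>

definition vec_stack :: "complex^'n^'m \<Rightarrow> complex^1^('n::finite \<times> 'm::finite)" where
  "vec_stack X = (\<chi> p k. X $ snd p $ fst p)"

definition K_B ::
    "complex^(('a::finite \<times> 'b::finite) \<times> ('a \<times> 'b))^(('a \<times> 'b) \<times> ('a \<times> 'b))" where
  "K_B = (\<Sum>i\<in>UNIV. \<Sum>j\<in>UNIV.
     kron (kron (mat 1) (unit_mat j i)) (kron (mat 1) (unit_mat i j)))"

end

theory Submission
  imports Defs
begin

text \<open>
  Let \<open>A(t)\<close> be the partial transpose of \<open>\<rho>(t)\<close>, \<open>S\<close> the sign of \<open>A(t\<^sub>0)\<close> and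
  \<open>P = S A(t\<^sub>0)\<close> its absolute value, which is positive definite.  The map \<open>X \<mapsto> X\<^sup>2\<close> has the
  derivative \<open>H \<mapsto> P H + H P\<close> at \<open>P\<close>, and this is injective because \<open>P\<close> is coercive.  The
  inverse function theorem thus gives a differentiable local square root \<open>R(t)\<close> of \<open>A(t)\<^sup>2\<close>
  near \<open>P\<close>.  It is Hermitian by local injectivity (its adjoint is a nearby root of the same matrix) and
  positive definite since it is close to \<open>P\<close>, hence it is the positive semidefinite root.  Multiplying
  \<open>P R' + R' P = A A' + A' A\<close> by the inverse of \<open>P\<close> and taking traces gives \<open>Tr R' = Tr (S A')\<close>.
  No spectral theorem is needed: the only roots in question lie near \<open>P\<close>.
\<close>

section \<open>Adjoints and the real inner product\<close>

lemma dagger_nth [simp]: "dagger X $ i $ j = cnj (X $ j $ i)"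
  by (simp add: dagger_def cconj_def transpose_def)

lemma dagger_dagger [simp]: "dagger (dagger X) = X"
  by (simp add: vec_eq_iff)

lemma dagger_mult: "dagger (X ** Y) = dagger Y ** dagger X"
  by (simp add: vec_eq_iff matrix_matrix_mult_def mult.commute)

text \<open>On complex numbers \<open>inner x y\<close> is the real part of
  \<open>cnj x * y\<close>. Multiplication by \<open>a\<close> still has multiplication by
  \<open>cnj a\<close> as its adjoint, so the usual rule survives for the real inner
  product.\<close>

lemma inner_matrix_vector_dagger: "inner x (A *v y) = inner (dagger A *v x) y"
  for A :: "complex^'n^'m"
proof -
  have "inner x (A *v y) = (\<Sum>i\<in>UNIV. \<Sum>j\<in>UNIV. inner (x $ i) (A $ i $ j * y $ j))"
    by (simp add: inner_vec_def matrix_vector_mult_def inner_sum_right)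
  also have "\<dots> = (\<Sum>j\<in>UNIV. \<Sum>i\<in>UNIV. inner (cnj (A $ i $ j) * x $ i) (y $ j))"
    by (subst sum.swap) (simp add: inner_complex_def algebra_simps)
  also have "\<dots> = inner (dagger A *v x) y"
    by (simp add: inner_vec_def matrix_vector_mult_def inner_sum_left)
  finally show ?thesis .
qed

text \<open>Left multiplication acts on each column separately, so bounds on the quadratic form of
  \<open>P\<close> carry over from vectors to matrices.\<close>

lemma inner_matrix_mult_columns:
  "inner H (P ** H) = (\<Sum>j\<in>UNIV. inner (column j H) (P *v column j H))"
  for P :: "complex^'m^'m" and H :: "complex^'n^'m"
  by (simp add: inner_vec_def matrix_matrix_mult_def matrix_vector_mult_def column_def)
     (rule sum.swap)

lemma inner_columns: "inner H H = (\<Sum>j\<in>UNIV. inner (column j H) (column j H))"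
  for H :: "complex^'n^'m"
  by (simp add: inner_vec_def column_def) (rule sum.swap)

lemma inner_dagger_dagger: "inner (dagger X) (dagger Y) = inner X Y"
  by (simp add: inner_vec_def inner_complex_def) (rule sum.swap)

lemma psd_iff_inner: "psd X \<longleftrightarrow> hermitian X \<and> (\<forall>v. 0 \<le> inner v (X *v v))"
  by (simp add: psd_def inner_vec_def inner_complex_def)

lemma coercive_psd:
  assumes "hermitian P" "0 \<le> c" "\<And>v. c * inner v v \<le> inner v (P *v v)"
  shows "psd P"
  unfolding psd_iff_inner using assms by (meson inner_ge_zero mult_nonneg_nonneg order_trans)

lemma bounded_bilinear_matrix_mult:
  "bounded_bilinear ((**) :: complex^'n^'m \<Rightarrow> complex^'p^'n \<Rightarrow> complex^'p^'m)"
  unfolding bilinear_conv_bounded_bilinear[symmetric] bilinear_def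
  by (auto intro!: linearI simp: algebra_simps matrix_matrix_mult_def vec_eq_iff sum_distrib_left
      scaleR_sum_right sum.distrib)

lemmas matrix_mult_diff =
  bounded_bilinear.diff_left[OF bounded_bilinear_matrix_mult]
  bounded_bilinear.diff_right[OF bounded_bilinear_matrix_mult]

section \<open>The Sylvester equation and positive definite square roots\<close>

text \<open>Pair the equation with \<open>H\<close>. The first term is at least
  \<open>c * inner H H\<close>; the second is nonnegative, since passing to adjoints turns right
  multiplication by \<open>Z\<close> into left multiplication. Taking \<open>Z\<close> to be another
  root gives uniqueness of roots, and \<open>Z = P\<close> gives injectivity of the derivative of
  squaring.\<close>

lemma sylvester_injective:
  fixes P Z H :: "complex^'n^'n"
  assumes c: "0 < c" and P: "\<And>v. c * inner v v \<le> inner v (P *v v)"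
    and Z: "psd Z" and eq: "P ** H + H ** Z = 0"
  shows "H = 0"
proof -
  have "c * inner H H \<le> inner H (P ** H)"
    unfolding inner_matrix_mult_columns inner_columns sum_distrib_left
    by (rule sum_mono) (rule P)
  moreover have "inner H (H ** Z) = inner (dagger H) (Z ** dagger H)"
    using Z inner_dagger_dagger[of H "H ** Z"] by (simp add: dagger_mult psd_def hermitian_def)
  moreover have "0 \<le> inner (dagger H) (Z ** dagger H)"
    using Z unfolding inner_matrix_mult_columns psd_iff_inner by (simp add: sum_nonneg)
  moreover have "inner H (P ** H) + inner H (H ** Z) = 0"
    by (simp add: eq flip: inner_add_right)
  ultimately have "c * inner H H \<le> 0" by linarith
  then have "inner H H \<le> 0" using c by (simp add: mult_le_0_iff)
  then show ?thesis by (metis inner_ge_zero inner_eq_zero_iff order_antisym)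
qed

lemma psd_sqrt_eqI:
  fixes P :: "complex^'n^'n"
  assumes c: "0 < c" and P: "\<And>v. c * inner v v \<le> inner v (P *v v)" and herm: "hermitian P"
  shows "psd_sqrt (P ** P) = P"
  unfolding psd_sqrt_def
proof (rule the_equality)
  show "psd P \<and> P ** P = P ** P"
    using coercive_psd[OF herm _ P] c by simp
next
  fix Y assume Y: "psd Y \<and> Y ** Y = P ** P"
  \<comment> \<open>The cross terms \<open>P ** Y\<close> cancel without \<open>P\<close> and
    \<open>Y\<close> commuting, leaving the difference of the two squares.\<close>
  have "P ** (P - Y) + (P - Y) ** Y = 0"
    using Y by (simp add: matrix_mult_diff)
  from sylvester_injective[OF c P _ this] Y show "Y = P" by simp
qed

section \<open>Linear operations and perturbation of coercivity\<close>

lemma bounded_bilinear_matrix_vector_mult: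
  "bounded_bilinear ((*v) :: complex^'n^'m \<Rightarrow> complex^'n \<Rightarrow> complex^'m)"
  unfolding bilinear_conv_bounded_bilinear[symmetric] bilinear_def
  by (auto intro!: linearI simp: algebra_simps matrix_vector_mult_def vec_eq_iff sum_distrib_left
      scaleR_sum_right sum.distrib)

lemma bounded_linear_dagger: "bounded_linear (dagger :: complex^'n^'m \<Rightarrow> complex^'m^'n)"
  unfolding linear_conv_bounded_linear[symmetric]
  by (auto intro!: linearI simp: vec_eq_iff)

lemma bounded_linear_trace: "bounded_linear (trace :: complex^'n^'n \<Rightarrow> complex)"
  unfolding linear_conv_bounded_linear[symmetric]
  by (auto intro!: linearI simp: trace_def sum.distrib scaleR_sum_right)

lemma bounded_linear_partial_transpose: "bounded_linear partial_transpose"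
  unfolding linear_conv_bounded_linear[symmetric]
  by (auto intro!: linearI simp: partial_transpose_def vec_eq_iff)

lemma trace_hermitian: "hermitian X \<Longrightarrow> trace X \<in> \<real>"
  unfolding hermitian_def trace_def
  by (intro sum_in_Reals) (metis dagger_nth Reals_cnj_iff)

lemma coercive_perturbation:
  fixes P :: "complex^'n^'n"
  assumes c: "0 < c" and P: "\<And>v. c * inner v v \<le> inner v (P *v v)"
  obtains e where "0 < e"
    "\<And>S v. dist P S < e \<Longrightarrow> c / 2 * inner v v \<le> inner v (S *v v)"
proof -
  obtain K where K: "0 < K"
    "\<And>(A::complex^'n^'n) v. norm (A *v v) \<le> norm A * norm v * K"
    using bounded_bilinear.pos_bounded[OF bounded_bilinear_matrix_vector_mult] by blast
  show ?thesis
  \<comment> \<open>Within this radius the form of \<open>P - S\<close> is at most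
    \<open>c / 2 * inner v v\<close>, so half of the coercivity of \<open>P\<close> remains.\<close>
  proof (rule that[of "c / (2 * K)"])
    show "0 < c / (2 * K)" using c K by simp
    fix S :: "complex^'n^'n" and v
    assume "dist P S < c / (2 * K)"
    then have d: "norm (P - S) * K \<le> c / 2"
      using K by (simp add: dist_norm field_simps)
    have "inner v ((P - S) *v v) \<le> norm v * norm ((P - S) *v v)"
      by (rule norm_cauchy_schwarz)
    also have "\<dots> \<le> norm v * (norm (P - S) * norm v * K)"
      by (intro mult_left_mono K) simp
    also have "\<dots> = (norm (P - S) * K) * (norm v * norm v)" by simp
    also have "\<dots> \<le> c / 2 * (norm v * norm v)"
      by (rule mult_right_mono[OF d]) simp
    also have "\<dots> = c / 2 * inner v v"
      by (simp add: power2_norm_eq_inner flip: power2_eq_square)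
    finally show "c / 2 * inner v v \<le> inner v (S *v v)"
      using P[of v] by (simp add: matrix_vector_mult_diff_rdistrib inner_diff_right)
  qed
qed

section \<open>A differentiable local branch of the matrix square root\<close>

text \<open>The inverse function theorem for squaring at \<open>P\<close>. The derivative
  \<open>g'\<close> is described only by the Sylvester equation it solves, which suffices for
  computing its trace.\<close>

lemma matrix_square_local_inverse:
  fixes P :: "complex^'n^'n"
  assumes c: "0 < c" and P: "\<And>v. c * inner v v \<le> inner v (P *v v)" and herm: "hermitian P"
  obtains W V g g' where "open W" "P \<in> W" "open V" "P ** P \<in> V"
    "homeomorphism W V (\<lambda>X. X ** X) g" "(g has_derivative g') (at (P ** P))"
    "\<And>X. P ** g' X + g' X ** P = X"
proof -
  interpret M: bounded_bilinear "(**) :: complex^'n^'n \<Rightarrow> complex^'n^'n \<Rightarrow> complex^'n^'n"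
    by (rule bounded_bilinear_matrix_mult)
  define F where "F X = M.prod_right X + M.prod_left X" for X
  have F: "blinfun_apply (F X) H = X ** H + H ** X" for X H
    by (simp add: F_def M.prod_right.rep_eq M.prod_left.rep_eq blinfun.add_left)
  have psd: "psd P" using coercive_psd[OF herm _ P] c by simp
  have "inj (blinfun_apply (F P))"
  proof (rule injI)
    fix X Y assume "blinfun_apply (F P) X = blinfun_apply (F P) Y"
    then have "P ** (X - Y) + (X - Y) ** P = 0"
      by (simp add: F matrix_mult_diff algebra_simps)
    then have "X - Y = 0" by (rule sylvester_injective[OF c P psd])
    then show "X = Y" by simp
  qed
  \<comment> \<open>In finite dimension \<open>G\<close> is bounded, so it provides the one-sided
    inverse of the derivative that the inverse function theorem asks for.\<close>
  then obtain G where G: "linear G" "G \<circ> blinfun_apply (F P) = id"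
    using linear_injective_left_inverse[OF bounded_linear.linear[OF blinfun.bounded_linear_right]]
    by blast
  have contF: "continuous_on UNIV F"
    unfolding F_def[abs_def]
    by (intro continuous_on_add linear_continuous_on M.bounded_linear_prod_right
        M.bounded_linear_prod_left)
  have derF: "((\<lambda>X. X ** X) has_derivative blinfun_apply (F X)) (at X)" if "X \<in> UNIV" for X
    using M.FDERIV[OF has_derivative_ident has_derivative_ident, of X UNIV]
    by (simp add: F[abs_def])
  have invF: "Blinfun G o\<^sub>L F P = id_blinfun"
    using G(1) fun_cong[OF G(2)]
    by (intro blinfun_eqI) (simp add: bounded_linear_Blinfun_apply linear_conv_bounded_linear)
  obtain W V g g' where *: "open W" "P \<in> W" "open V" "P ** P \<in> V"
    "homeomorphism W V (\<lambda>X. X ** X) g"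
    "\<And>y. y \<in> V \<Longrightarrow> (g has_derivative (g' y)) (at y)"
    "\<And>y. y \<in> V \<Longrightarrow> g' y = inv (blinfun_apply (F (g y)))"
    "\<And>y. y \<in> V \<Longrightarrow> bij (blinfun_apply (F (g y)))"
    by (rule inverse_function_theorem[OF open_UNIV derF contF UNIV_I invF]) (assumption, rule that)
  have gP: "g (P ** P) = P"
    using *(2,5) by (simp add: homeomorphism_def)
  show ?thesis
  proof (rule that[OF *(1-5) *(6)[OF *(4)]])
    fix X
    have "blinfun_apply (F P) (g' (P ** P) X) = X"
      using *(7,8)[OF *(4)] gP by (simp add: bij_is_surj surj_f_inv_f)
    then show "P ** g' (P ** P) X + g' (P ** P) X ** P = X" by (simp add: F)
  qed
qed

section \<open>The derivative of the trace norm\<close>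

text \<open>The equation need not be solved for \<open>T\<close>: after multiplication by the
  inverse \<open>Q\<close> of \<open>P\<close>, cyclicity of the trace makes the two terms on each
  side equal, and \<open>Q ** A = A ** Q = S\<close>.\<close>

lemma trace_sqrt_derivative:
  fixes P S A A' T :: "complex^'n^'n"
  assumes P: "P = S ** A" "P = A ** S" and S: "S ** S = mat 1" and A: "invertible A"
    and eq: "P ** T + T ** P = A ** A' + A' ** A"
  shows "trace T = trace (S ** A')"
proof -
  obtain B where B: "B ** A = mat 1" "A ** B = mat 1"
    using A by (auto simp: invertible_def)
  define Q where "Q = B ** S"
  have QP: "Q ** P = mat 1"
    unfolding Q_def P(1) using S B by (metis matrix_mul_assoc matrix_mul_rid)
  then have PQ: "P ** Q = mat 1" by (simp add: matrix_left_right_inverse)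
  have "A = S ** P" "A = P ** S"
    using S by (metis P(1) matrix_mul_assoc matrix_mul_lid, metis P(2) matrix_mul_assoc matrix_mul_rid)
  then have QA: "Q ** A = S" "A ** Q = S"
    by (metis QP matrix_mul_assoc matrix_mul_lid, metis PQ \<open>A = S ** P\<close> matrix_mul_assoc matrix_mul_rid)
  have "trace (Q ** (P ** T + T ** P)) = 2 * trace T"
    using QP PQ by (simp add: matrix_add_ldistrib trace_add matrix_mul_assoc)
      (metis matrix_mul_assoc matrix_mul_rid trace_mul_sym)
  moreover have "trace (Q ** (A ** A' + A' ** A)) = 2 * trace (S ** A')"
    using QA by (simp add: matrix_add_ldistrib trace_add matrix_mul_assoc)
      (metis matrix_mul_assoc trace_mul_sym)
  ultimately show ?thesis using eq by simp
qed

text \<open>The sign \<open>S\<close> and absolute value \<open>P\<close> of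
  \<open>A t\<^sub>0\<close> enter through their algebraic relations, with no reference to
  eigenvectors. The norm is embedded in the complex numbers so that its derivative can be a complex
  trace.\<close>

lemma trace_norm_has_derivative:
  fixes A :: "real \<Rightarrow> complex^'n^'n"
  assumes herm: "\<forall>\<^sub>F t in nhds t\<^sub>0. hermitian (A t)"
    and A': "(A has_vector_derivative A') (at t\<^sub>0)"
    and inv: "invertible (A t\<^sub>0)"
    and S: "S ** S = mat 1" and P: "P = S ** A t\<^sub>0" "P = A t\<^sub>0 ** S" and Ph: "hermitian P"
    and c: "0 < c" "\<And>v. c * inner v v \<le> inner v (P *v v)"
  shows "((\<lambda>t. complex_of_real (trace_norm (A t))) has_vector_derivative trace (S ** A')) (at t\<^sub>0)"
proof -
  have PP: "P ** P = A t\<^sub>0 ** A t\<^sub>0"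
    using P S by (metis matrix_mul_assoc matrix_mul_lid)
  obtain W V g g' where W: "open W" "P \<in> W" and V: "open V" "P ** P \<in> V"
    and hom: "homeomorphism W V (\<lambda>X. X ** X) g" and g': "(g has_derivative g') (at (P ** P))"
    and g'_eq: "\<And>X. P ** g' X + g' X ** P = X"
    using matrix_square_local_inverse[OF c Ph] by blast
  obtain e where e: "0 < e"
    "\<And>S v. dist P S < e \<Longrightarrow> c / 2 * inner v v \<le> inner v (S *v v)"
    using coercive_perturbation[OF c] by blast
  define R where "R t = g (A t ** A t)" for t
  have AA': "((\<lambda>t. A t ** A t) has_vector_derivative (A t\<^sub>0 ** A' + A' ** A t\<^sub>0)) (at t\<^sub>0)"
    by (rule bounded_bilinear.has_vector_derivative[OF bounded_bilinear_matrix_mult A' A'])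
  then have contA: "isCont (\<lambda>t. A t ** A t) t\<^sub>0"
    by (rule has_vector_derivative_continuous)
  define T where "T = g' (A t\<^sub>0 ** A' + A' ** A t\<^sub>0)"
  have R': "(R has_vector_derivative T) (at t\<^sub>0)"
    using vector_derivative_diff_chain_within[of "\<lambda>t. A t ** A t", OF AA', of g g']
      has_derivative_at_withinI[OF g'] unfolding R_def T_def PP comp_def by simp
  have R0: "R t\<^sub>0 = P"
    using hom W unfolding R_def PP[symmetric] by (simp add: homeomorphism_def)
  have tends: "(R \<longlongrightarrow> P) (nhds t\<^sub>0)"
    using has_vector_derivative_continuous[OF R']
    unfolding isCont_def tendsto_at_iff_tendsto_nhds by (simp only: R0)
  have open_dagger: "open (dagger -` W)"
    by (intro open_vimage W(1) linear_continuous_on bounded_linear_dagger)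
  \<comment> \<open>Three conditions hold near \<open>t\<^sub>0\<close>: the square lies in
    \<open>V\<close>, so \<open>R t\<close> is a root of it; \<open>R t\<close> is close enough to
    \<open>P\<close> to be coercive; and the adjoint of \<open>R t\<close> lies in \<open>W\<close>,
    where squaring is injective.\<close>
  have "\<forall>\<^sub>F t in nhds t\<^sub>0. trace_norm (A t) = trace (R t)"
  proof -
    have "\<forall>\<^sub>F t in nhds t\<^sub>0. A t ** A t \<in> V"
      using contA V
      unfolding PP isCont_def tendsto_at_iff_tendsto_nhds[of "\<lambda>t. A t ** A t"]
      by (rule topological_tendstoD)
    moreover have "\<forall>\<^sub>F t in nhds t\<^sub>0. R t \<in> ball P e"
      using tends e by (intro topological_tendstoD) auto
    moreover have "\<forall>\<^sub>F t in nhds t\<^sub>0. R t \<in> dagger -` W"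
      using tends W(2) Ph open_dagger by (intro topological_tendstoD) (auto simp: hermitian_def)
    ultimately show ?thesis using herm
    proof eventually_elim
      case (elim t)
      have RW: "R t \<in> W" and RR: "R t ** R t = A t ** A t"
        using hom elim(1) unfolding R_def homeomorphism_def by auto
      \<comment> \<open>Both \<open>R t\<close> and its adjoint are recovered by \<open>g\<close>
        from their squares, and these squares agree because \<open>A t\<close> is Hermitian.\<close>
      have "g (R t ** R t) = R t" "g (dagger (R t) ** dagger (R t)) = dagger (R t)"
        using hom RW elim(3) unfolding homeomorphism_def by auto
      moreover have "dagger (R t) ** dagger (R t) = R t ** R t"
        using RR elim(4) by (metis dagger_mult hermitian_def)
      ultimately have Rh: "hermitian (R t)" by (simp add: hermitian_def)
      have "psd_sqrt (R t ** R t) = R t"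
        using elim(2) c(1) e(2) Rh by (intro psd_sqrt_eqI[of "c / 2"]) auto
      then have "trace_norm (A t) = Re (trace (R t))"
        using RR elim(4) unfolding trace_norm_def hermitian_def by simp
      then show ?case using trace_hermitian[OF Rh] by simp
    qed
  qed
  moreover have "((\<lambda>t. trace (R t)) has_vector_derivative trace T) (at t\<^sub>0)"
    by (rule bounded_linear.has_vector_derivative[OF bounded_linear_trace R'])
  ultimately have "((\<lambda>t. complex_of_real (trace_norm (A t))) has_vector_derivative trace T) (at t\<^sub>0)"
    by (subst has_vector_derivative_cong_ev[where g = "\<lambda>t. trace (R t)"])
       (auto dest: eventually_nhds_x_imp_x elim: eventually_mono)
  moreover have "trace T = trace (S ** A')"
    using trace_sqrt_derivative[OF P S inv] g'_eq unfolding T_def by blast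
  ultimately show ?thesis by simp
qed

section \<open>Unitary diagonalisation\<close>

text \<open>The substitution \<open>w = dagger U *v v\<close> preserves the norm and turns the form
  into a sum of squares weighted by the \<open>d i\<close>.\<close>

lemma unitary_conj_diagonal_coercive:
  fixes U D :: "complex^'n^'n"
  assumes U: "unitary U" and diag: "\<And>i j. i \<noteq> j \<Longrightarrow> D $ i $ j = 0"
    and pos: "\<And>i. D $ i $ i = complex_of_real (d i)" "\<And>i. c \<le> d i"
  shows "c * inner v v \<le> inner v ((U ** D ** dagger U) *v v)"
proof -
  define w where "w = dagger U *v v"
  have "inner v v = inner v ((U ** dagger U) *v v)"
    using U by (simp add: unitary_def)
  also have "\<dots> = inner w w"
    by (simp add: w_def inner_matrix_vector_dagger flip: matrix_vector_mul_assoc)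
  finally have vw: "inner v v = inner w w" .
  have Dw: "(D *v w) $ i = d i *\<^sub>R w $ i" for i
  proof -
    have "(D *v w) $ i = (\<Sum>j\<in>UNIV. if j = i then D $ i $ i * w $ i else 0)"
      unfolding matrix_vector_mult_def vec_lambda_beta by (rule sum.cong) (auto simp: diag)
    then show ?thesis by (simp add: pos scaleR_conv_of_real)
  qed
  have "c * inner w w \<le> inner w (D *v w)"
    unfolding inner_vec_def sum_distrib_left Dw
    by (rule sum_mono) (simp add: mult_right_mono pos)
  also have "\<dots> = inner v ((U ** D ** dagger U) *v v)"
    by (simp add: w_def inner_matrix_vector_dagger flip: matrix_vector_mul_assoc)
  finally show ?thesis by (simp add: vw)
qed

lemma diagonal_mult_component:
  fixes D E :: "complex^'n^'n"
  assumes "\<And>i j. i \<noteq> j \<Longrightarrow> D $ i $ j = 0" "\<And>i j. i \<noteq> j \<Longrightarrow> E $ i $ j = 0"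
  shows "(D ** E) $ i $ j = (if i = j then D $ i $ i * E $ i $ i else 0)"
proof -
  have "(D ** E) $ i $ j = (\<Sum>k\<in>UNIV. if k = i then D $ i $ i * E $ i $ j else 0)"
    unfolding matrix_matrix_mult_def vec_lambda_beta by (rule sum.cong) (auto simp: assms)
  then show ?thesis by (simp add: assms)
qed

section \<open>The matrix \<open>K_B\<close> and vectorisation\<close>

text \<open>At most one term of the double sum contributes to each entry. Thus \<open>K_B\<close> is
  the permutation matrix exchanging the second-factor components of the two indices.\<close>

lemma K_B_nth:
  "K_B $ p $ q = (if fst (fst p) = fst (fst q) \<and> fst (snd p) = fst (snd q)
     \<and> snd (fst p) = snd (snd q) \<and> snd (snd p) = snd (fst q) then 1 else 0)"
proof -
  have "K_B $ p $ q = (\<Sum>i\<in>UNIV. \<Sum>j\<in>UNIV. if i = snd (fst q) \<and> j = snd (fst p) then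
     (if fst (fst p) = fst (fst q) \<and> fst (snd p) = fst (snd q)
     \<and> snd (fst p) = snd (snd q) \<and> snd (snd p) = snd (fst q) then 1 else 0) else 0)"
    unfolding K_B_def sum_component
    by (intro sum.cong refl) (auto simp: kron_def unit_mat_def mat_def)
  also have "\<dots> = (\<Sum>i\<in>UNIV. if i = snd (fst q) then
     (if fst (fst p) = fst (fst q) \<and> fst (snd p) = fst (snd q)
     \<and> snd (fst p) = snd (snd q) \<and> snd (snd p) = snd (fst q) then 1 else 0) else 0)"
    by (intro sum.cong refl) auto
  finally show ?thesis by simp
qed

text \<open>The index of a stacked vector is a column index followed by a row index; exchanging
  their second-factor components is exactly partial transposition.\<close>

lemma K_B_mult_vec_stack: "K_B ** vec_stack X = vec_stack (partial_transpose X)"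
proof -
  have "(K_B ** vec_stack X) $ p $ k = vec_stack (partial_transpose X) $ p $ k" for p k
  proof -
    have "(K_B ** vec_stack X) $ p $ k = (\<Sum>q\<in>UNIV. if q = ((fst (fst p), snd (snd p)), (fst (snd p), snd (fst p)))
       then vec_stack X $ q $ k else 0)"
      unfolding matrix_matrix_mult_def vec_lambda_beta
      by (rule sum.cong) (auto simp: K_B_nth prod_eq_iff)
    then show ?thesis by (simp add: vec_stack_def partial_transpose_def)
  qed
  then show ?thesis by (simp add: vec_eq_iff)
qed

text \<open>This pairing is bilinear, without conjugation, so the trace involves the transpose of
  \<open>M\<close> and not its adjoint.\<close>

lemma transpose_vec_stack_mult:
  "(transpose (vec_stack M) ** vec_stack X) $ 1 $ 1 = trace (transpose M ** X)"
  by (simp add: matrix_matrix_mult_def trace_def transpose_def vec_stack_def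
      sum.cartesian_product flip: UNIV_Times_UNIV)
     (simp add: case_prod_unfold)

section \<open>The derivative of the negativity\<close>

theorem mainTheorem1:
  fixes \<rho> :: "real \<Rightarrow> complex^('a::finite \<times> 'b::finite)^('a \<times> 'b)"
    and \<rho>' U \<Lambda> :: "complex^('a \<times> 'b)^('a \<times> 'b)"
    and t\<^sub>0 :: real
  assumes density: "\<forall>\<^sub>F t in nhds t\<^sub>0. density_matrix (\<rho> t)"
    and deriv: "(\<rho> has_vector_derivative \<rho>') (at t\<^sub>0)"
    and inv: "invertible (partial_transpose (\<rho> t\<^sub>0))"
    and U: "unitary U"
    and \<Lambda>: "real_diagonal \<Lambda>"
    and eigen: "partial_transpose (\<rho> t\<^sub>0) = U ** \<Lambda> ** dagger U"
  shows "(\<lambda>t. negativity (\<rho> t)) differentiable (at t\<^sub>0)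
    \<and> complex_of_real (deriv (\<lambda>t. negativity (\<rho> t)) t\<^sub>0)
        = 1 / 2 * (transpose (vec_stack (cconj U ** sign_mat \<Lambda> ** transpose U))
                     ** K_B ** vec_stack \<rho>') $ 1 $ 1"
proof -
  define A where "A t = partial_transpose (\<rho> t)" for t
  define A' where "A' = partial_transpose \<rho>'"
  define G where "G = sign_mat \<Lambda>"
  define S where "S = U ** G ** dagger U"
  define l where "l i = Re (\<Lambda> $ i $ i)" for i
  have UU: "dagger U ** U = mat 1" "U ** dagger U = mat 1"
    using U by (auto simp: unitary_def)
  have cancel: "X ** dagger U ** U = X" for X :: "complex^('a \<times> 'b)^('a \<times> 'b)"
    by (simp add: UU flip: matrix_mul_assoc)
  have conj_mult: "(U ** X ** dagger U) ** (U ** Y ** dagger U) = U ** (X ** Y) ** dagger U" for X Y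
    by (simp add: cancel matrix_mul_assoc)
  have offdiag: "\<Lambda> $ i $ j = 0" "G $ i $ j = 0" if "i \<noteq> j" for i j
    using \<Lambda> that by (simp_all add: real_diagonal_def G_def sign_mat_def del: split_paired_All)
  have dg: "\<Lambda> $ i $ i = complex_of_real (l i)" "G $ i $ i = complex_of_real (sgn (l i))" for i
    using \<Lambda> by (simp_all add: real_diagonal_def G_def sign_mat_def l_def del: split_paired_All)
  note prods = diagonal_mult_component[OF offdiag(2) offdiag(1)]
    diagonal_mult_component[OF offdiag(1) offdiag(2)]
    diagonal_mult_component[OF offdiag(2) offdiag(2)]
  \<comment> \<open>A zero eigenvalue would put the nonzero column \<open>U *v axis i 1\<close> into
    the kernel of the invertible matrix \<open>A t\<^sub>0\<close>.\<close>
  have l_nz: "l i \<noteq> 0" for i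
  proof
    assume "l i = 0"
    then have "(\<Lambda> *v axis i 1) $ j = 0" for j
      using offdiag(1)[of j i] dg[of i]
      by (cases "j = i") (simp_all add: matrix_vector_mult_def axis_def if_distrib cong: if_cong)
    then have "\<Lambda> *v axis i 1 = 0" by (simp only: vec_eq_iff zero_index) blast
    then have "A t\<^sub>0 *v (U *v axis i 1) = 0"
      by (simp add: A_def eigen matrix_vector_mul_assoc cancel)
        (simp flip: matrix_vector_mul_assoc)
    then have "U *v axis i 1 = 0"
      using inv unfolding A_def invertible_def
      by (metis matrix_vector_mul_assoc matrix_vector_mul_lid matrix_vector_mult_0_right)
    then have "axis i (1::complex) = 0"
      by (metis UU(1) matrix_vector_mul_assoc matrix_vector_mul_lid matrix_vector_mult_0_right)
    then show False by (simp add: axis_eq_0_iff)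
  qed
  \<comment> \<open>The smallest absolute eigenvalue serves as coercivity constant of the absolute
    value of \<open>A t\<^sub>0\<close>.\<close>
  define c where "c = Min (range (\<lambda>i. \<bar>l i\<bar>))"
  have "0 < c" unfolding c_def by (subst Min_gr_iff) (auto simp: l_nz)
  have c_le: "c \<le> \<bar>l i\<bar>" for i unfolding c_def by (rule Min_le) auto
  \<comment> \<open>\<open>D\<close> is the absolute value of \<Lambda>, so
    \<open>U ** D ** dagger U\<close> will play the role of \<open>P\<close>. That \<open>G\<close>
    squares to the identity rests on \<open>l_nz\<close>, since \<open>sgn 0 = 0\<close>.\<close>
  define D where "D = G ** \<Lambda>"
  have D: "D = \<Lambda> ** G" "G ** G = mat 1"
    unfolding D_def by (auto simp: vec_eq_iff prods dg mat_def sgn_if l_nz)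
  have D_nth: "D $ i $ j = (if i = j then complex_of_real \<bar>l i\<bar> else 0)" for i j
    by (simp add: D_def prods dg sgn_if)
  have A': "(A has_vector_derivative A') (at t\<^sub>0)"
    unfolding A_def A'_def
    by (rule bounded_linear.has_vector_derivative[OF bounded_linear_partial_transpose deriv])
  have herm: "\<forall>\<^sub>F t in nhds t\<^sub>0. hermitian (A t)"
    using density
  proof eventually_elim
    case (elim t)
    then have "dagger (\<rho> t) = \<rho> t" by (simp add: density_matrix_def psd_def hermitian_def)
    then have "cnj (\<rho> t $ i $ j) = \<rho> t $ j $ i" for i j by (metis dagger_nth)
    then show ?case by (simp add: A_def hermitian_def partial_transpose_def vec_eq_iff)
  qed
  have cderiv: "((\<lambda>t. complex_of_real (trace_norm (A t))) has_vector_derivative trace (S ** A')) (at t\<^sub>0)"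
  proof (rule trace_norm_has_derivative[OF herm A' _ _ _ _ _ \<open>0 < c\<close>])
    show "invertible (A t\<^sub>0)" using inv by (simp add: A_def)
    show "S ** S = mat 1" by (simp add: S_def conj_mult D UU)
    show "U ** D ** dagger U = S ** A t\<^sub>0" "U ** D ** dagger U = A t\<^sub>0 ** S"
      by (simp_all add: S_def A_def eigen conj_mult flip: D_def D(1))
    have "dagger D = D" by (simp add: vec_eq_iff D_nth)
    then show "hermitian (U ** D ** dagger U)"
      by (simp add: hermitian_def dagger_mult matrix_mul_assoc)
    show "c * inner v v \<le> inner v ((U ** D ** dagger U) *v v)" for v
      by (rule unitary_conj_diagonal_coercive[OF U, where d = "\<lambda>i. \<bar>l i\<bar>"]) (auto simp: D_nth c_le)
  qed
  have re: "((\<lambda>t. trace_norm (A t)) has_vector_derivative Re (trace (S ** A'))) (at t\<^sub>0)"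
    using bounded_linear.has_vector_derivative[OF bounded_linear_Re cderiv] by simp
  \<comment> \<open>The embedded real derivative is also a derivative of the same function, so
    uniqueness forces the trace to be real.\<close>
  have "((\<lambda>t. complex_of_real (trace_norm (A t))) has_vector_derivative
      complex_of_real (Re (trace (S ** A')))) (at t\<^sub>0)"
    by (rule bounded_linear.has_vector_derivative[OF bounded_linear_of_real re])
  then have tr: "complex_of_real (Re (trace (S ** A'))) = trace (S ** A')"
    using cderiv vector_derivative_unique_at by blast
  have neg: "((\<lambda>t. negativity (\<rho> t)) has_real_derivative Re (trace (S ** A')) / 2) (at t\<^sub>0)"
    using re unfolding negativity_def A_def[symmetric] has_real_derivative_iff_has_vector_derivative[symmetric]
    by (auto intro!: derivative_eq_intros)
  \<comment> \<open>The conjugated matrix in the claimed formula is the transpose of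
    \<open>S\<close>, which undoes the transpose coming from the pairing of stacked vectors.\<close>
  have "transpose G = G"
    by (simp add: vec_eq_iff transpose_def G_def sign_mat_def)
  then have "transpose (cconj U ** G ** transpose U) = S"
    by (simp add: S_def matrix_transpose_mul dagger_def matrix_mul_assoc)
  then have "(transpose (vec_stack (cconj U ** G ** transpose U)) ** K_B ** vec_stack \<rho>') $ 1 $ 1
      = trace (S ** A')"
    by (simp add: K_B_mult_vec_stack transpose_vec_stack_mult A'_def flip: matrix_mul_assoc)
  then show ?thesis
    using neg tr by (auto simp: DERIV_imp_deriv G_def real_differentiable_def)
qed

end
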